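(* There exist compositions $\zeta$ for which the polynomial $K_\zeta^{(\alpha,\beta,\gamma)}(\boldsymbol{x})$, expanded in monomials in $\alpha,\beta,\gamma,x_1,\ldots,x_n$, has negative coefficients.
   Context: $\alpha,\beta,\gamma,x_1,\ldots,x_n$ are indeterminates. Let $\partial_i(f)=\dfrac{f(x_1,\ldots,x_{i-1},x_{i+1},x_i,x_{i+2},\ldots,x_n)-f(x_1,\ldots,x_n)}{x_{i+1}-x_i}$ and, for $1\le i\le n-1$, $$T_i^{(\alpha,\beta,\gamma)}=-\beta+\big((\alpha+\beta+\gamma)x_i+\gamma x_{i+1}+1+(\beta+\gamma)(\alpha+\gamma)x_ix_{i+1}\big)\partial_i .$$ These operators satisfy the braid relations, so $T_w^{(\alpha,\beta,\gamma)}=T_{i_1}^{(\alpha,\beta,\gamma)}\circ\cdots\circ T_{i_\ell}^{(\alpha,\beta,\gamma)}$ is well defined for any reduced decomposition $w=s_{i_1}\cdots s_{i_\ell}\in S_n$. For a (weak) composition $\zeta=(\zeta_1,\ldots,\zeta_n)$ with $n$ nonnegative integer parts, let $\zeta^+=(\zeta_1^+\ge\cdots\ge\zeta_n^+)$ be the unique partition obtained by reordering the parts of $\zeta$, and let $v_\zeta\in S_n$ be the minimal length representative (of a coset in $S_n/\mathrm{stab}(\zeta^+)$) with $v_\zeta\cdot\zeta=\zeta^+$; that is, $v_\zeta$ is the permutation of minimal length such that $\zeta_{v_\zeta(i)}=\zeta_i^+$ for all $i$. Then $K_\zeta^{(\alpha,\beta,\gamma)}(\boldsymbol{x})=T_{v_\zeta}^{(\alpha,\beta,\gamma)}\big(x_1^{\zeta_1^+}\cdots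 x_n^{\zeta_n^+}\big)$. *)

theory Defs
  imports "HOL-Library.Poly_Mapping" "HOL-Combinatorics.Permutations"
begin

datatype indet = Alpha | Beta | Gamma | X nat

text \<open>
  The polynomial ring over the integers in \<open>\<alpha>, \<beta>, \<gamma>, x\<^sub>1, x\<^sub>2, \<dots>\<close>. A monomial is a finitely supported
  exponent vector, and the coefficient of the monomial \<open>m\<close> in \<open>f\<close> is \<open>Poly_Mapping.lookup f m\<close>.
\<close>

type_synonym monomial = "indet \<Rightarrow>\<^sub>0 nat"
type_synonym mpolynomial = "monomial \<Rightarrow>\<^sub>0 int"

text \<open>
  An arbitrary linear order on the indeterminates; its only purpose is that the library then
  provides the \<^class>\<open>idom\<close> instance of \<^typ>\<open>mpolynomial\<close>.
\<close>

primrec indet_index :: "indet \<Rightarrow> nat" where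
  "indet_index Alpha = 0"
| "indet_index Beta = 1"
| "indet_index Gamma = 2"
| "indet_index (X i) = i + 3"

lemma indet_index_inject: "indet_index u = indet_index v \<longleftrightarrow> u = v"
  by (cases u; cases v) auto

instantiation indet :: linorder
begin
definition "u \<le> v \<longleftrightarrow> indet_index u \<le> indet_index v"
definition "u < v \<longleftrightarrow> indet_index u < indet_index v"
instance
  by standard (auto simp: less_eq_indet_def less_indet_def indet_index_inject)
end

definition Var :: "indet \<Rightarrow> mpolynomial" where
  "Var v = Poly_Mapping.single (Poly_Mapping.single v 1) 1"

abbreviation xv :: "nat \<Rightarrow> mpolynomial" where "xv i \<equiv> Var (X i)"
abbreviation \<alpha> :: mpolynomial where "\<alpha> \<equiv> Var Alpha"
abbreviation \<beta> :: mpolynomial where "\<beta> \<equiv> Var Beta"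
abbreviation \<gamma> :: mpolynomial where "\<gamma> \<equiv> Var Gamma"

text \<open>
  \<open>swap_x i f = f(\<dots>, x\<^sub>i\<^sub>+\<^sub>1, x\<^sub>i, \<dots>)\<close>: the coefficient of a monomial in \<open>swap_x i f\<close> is the coefficient in
  \<open>f\<close> of the monomial with the exponents of \<open>x\<^sub>i\<close> and \<open>x\<^sub>i\<^sub>+\<^sub>1\<close> exchanged.
\<close>

definition swap_mon :: "nat \<Rightarrow> monomial \<Rightarrow> monomial" where
  "swap_mon i = Poly_Mapping.map_key (transpose (X i) (X (Suc i)))"

definition swap_x :: "nat \<Rightarrow> mpolynomial \<Rightarrow> mpolynomial" where
  "swap_x i = Poly_Mapping.map_key (swap_mon i)"

text \<open>
  The quotient is taken in the polynomial ring; it exists and is unique, see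
  \<open>divided_difference_ex1\<close> below.
\<close>

definition divided_difference :: "nat \<Rightarrow> mpolynomial \<Rightarrow> mpolynomial" where
  "divided_difference i f = (THE g. g * (xv (Suc i) - xv i) = swap_x i f - f)"

definition T_op :: "nat \<Rightarrow> mpolynomial \<Rightarrow> mpolynomial" where
  "T_op i f = - \<beta> * f +
     ((\<alpha> + \<beta> + \<gamma>) * xv i + \<gamma> * xv (Suc i) + 1 + (\<beta> + \<gamma>) * (\<alpha> + \<gamma>) * xv i * xv (Suc i))
       * divided_difference i f"

text \<open>
  Permutations in \<open>S\<^sub>n\<close> are functions \<open>w\<close> with \<open>w permutes {1..n}\<close>. A word \<open>[i\<^sub>1, \<dots>, i\<^sub>l]\<close> stands for
  \<open>s\<^bsub>i\<^sub>1\<^esub> \<circ> \<dots> \<circ> s\<^bsub>i\<^sub>l\<^esub>\<close>, where the rightmost factor acts first.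
\<close>

definition word_perm :: "nat list \<Rightarrow> nat \<Rightarrow> nat" where
  "word_perm is = foldr (\<lambda>i w. transpose i (Suc i) \<circ> w) is id"

definition perm_length :: "nat \<Rightarrow> (nat \<Rightarrow> nat) \<Rightarrow> nat" where
  "perm_length n w = (LEAST l. \<exists>is. set is \<subseteq> {1..<n} \<and> word_perm is = w \<and> length is = l)"

definition reduced_word :: "nat \<Rightarrow> (nat \<Rightarrow> nat) \<Rightarrow> nat list \<Rightarrow> bool" where
  "reduced_word n w is \<longleftrightarrow>
     set is \<subseteq> {1..<n} \<and> word_perm is = w \<and> length is = perm_length n w"

text \<open>
  By the braid relations the choice of the reduced word is immaterial.
\<close>

definition T_perm :: "nat \<Rightarrow> (nat \<Rightarrow> nat) \<Rightarrow> mpolynomial \<Rightarrow> mpolynomial" where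
  "T_perm n w = foldr T_op (SOME is. reduced_word n w is)"

text \<open>
  A weak composition with \<open>n\<close> parts is a list of length \<open>n\<close>; its part \<open>\<zeta>\<^sub>i\<close> is \<open>\<zeta> ! (i - 1)\<close>, as list
  positions start at \<open>0\<close>.
\<close>

definition part :: "nat list \<Rightarrow> nat \<Rightarrow> nat" where
  "part \<zeta> i = \<zeta> ! (i - 1)"

definition sorted_partition :: "nat list \<Rightarrow> nat list" where
  "sorted_partition \<zeta> = rev (sort \<zeta>)"

definition min_perm :: "nat list \<Rightarrow> nat \<Rightarrow> nat" where
  "min_perm \<zeta> = (ARG_MIN (perm_length (length \<zeta>)) v.
     v permutes {1..length \<zeta>} \<and>
     (\<forall>i\<in>{1..length \<zeta>}. part \<zeta> (v i) = part (sorted_partition \<zeta>) i))"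

definition K_poly :: "nat list \<Rightarrow> mpolynomial" where
  "K_poly \<zeta> = T_perm (length \<zeta>) (min_perm \<zeta>)
            (\<Prod>i\<in>{1..length \<zeta>}. xv i ^ part (sorted_partition \<zeta>) i)"


lemma lookup_swap_mon:
  "Poly_Mapping.lookup (swap_mon i m) v = Poly_Mapping.lookup m (transpose (X i) (X (Suc i)) v)"
  by (simp add: swap_mon_def map_key.rep_eq)

lemma swap_mon_swap_mon [simp]: "swap_mon i (swap_mon i m) = m"
  by (rule poly_mapping_eqI) (simp add: lookup_swap_mon)

lemma inj_swap_mon: "inj (swap_mon i)"
  by (metis injI swap_mon_swap_mon)

lemma lookup_swap_x: "Poly_Mapping.lookup (swap_x i f) m = Poly_Mapping.lookup f (swap_mon i m)"
  by (simp add: swap_x_def map_key.rep_eq inj_swap_mon)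

lemma swap_x_add: "swap_x i (f + g) = swap_x i f + swap_x i g"
  by (rule poly_mapping_eqI) (simp add: lookup_swap_x lookup_add)

lemma swap_x_single:
  "swap_x i (Poly_Mapping.single m c) = Poly_Mapping.single (swap_mon i m) c"
  using map_key_single[OF inj_swap_mon, of i "swap_mon i m" c] by (simp add: swap_x_def)

lemma Var_power: "Var v ^ k = Poly_Mapping.single (Poly_Mapping.single v k) 1"
proof (induction k)
  case 0
  then show ?case by (simp add: single_one)
next
  case (Suc k)
  then show ?case by (simp add: Var_def mult_single single_add[symmetric])
qed

lemma diff_x_nonzero: "xv (Suc i) - xv i \<noteq> 0"
proof
  assume "xv (Suc i) - xv i = 0"
  then have "Poly_Mapping.lookup (xv (Suc i)) (Poly_Mapping.single (X i) 1)
           = Poly_Mapping.lookup (xv i) (Poly_Mapping.single (X i) 1)"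
    by simp
  moreover have "Poly_Mapping.single (X (Suc i)) (1::nat) \<noteq> Poly_Mapping.single (X i) 1"
  proof
    assume "Poly_Mapping.single (X (Suc i)) (1::nat) = Poly_Mapping.single (X i) 1"
    then have "Poly_Mapping.lookup (Poly_Mapping.single (X (Suc i)) (1::nat)) (X i)
             = Poly_Mapping.lookup (Poly_Mapping.single (X i) 1) (X i)" by simp
    then show False by (simp add: lookup_single)
  qed
  ultimately show False
    by (simp add: Var_def lookup_single)
qed

lemma divided_difference_dvd: "xv (Suc i) - xv i dvd swap_x i f - f"
proof (induction f rule: update_induct)
  case const
  have "swap_x i 0 = 0"
    by (rule poly_mapping_eqI) (simp add: lookup_swap_x)
  then show ?case by simp
next
  case (update f m c)
  define a b where "a = Poly_Mapping.lookup m (X i)" and "b = Poly_Mapping.lookup m (X (Suc i))"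
  define r where "r = Poly_Mapping.update (X i) 0 (Poly_Mapping.update (X (Suc i)) 0 m)"
  have m: "m = r + Poly_Mapping.single (X i) a + Poly_Mapping.single (X (Suc i)) b"
    by (rule poly_mapping_eqI)
      (auto simp: r_def a_def b_def lookup_add lookup_single lookup_update when_def)
  have s: "swap_mon i m = r + Poly_Mapping.single (X i) b + Poly_Mapping.single (X (Suc i)) a"
    by (rule poly_mapping_eqI)
      (auto simp: r_def a_def b_def lookup_add lookup_single lookup_update when_def
        lookup_swap_mon transpose_def)
  have "Poly_Mapping.single m c = Poly_Mapping.single r c * xv i ^ a * xv (Suc i) ^ b"
    by (subst m) (simp add: Var_power mult_single)
  moreover have "Poly_Mapping.single (swap_mon i m) c
               = Poly_Mapping.single r c * xv i ^ b * xv (Suc i) ^ a"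
    by (subst s) (simp add: Var_power mult_single)
  ultimately have "swap_x i (Poly_Mapping.single m c) - Poly_Mapping.single m c =
      Poly_Mapping.single r c * xv i ^ b * (xv (Suc i) ^ a - xv i ^ a)
    - Poly_Mapping.single r c * xv i ^ a * (xv (Suc i) ^ b - xv i ^ b)"
    by (subst swap_x_single) (simp add: algebra_simps)
  moreover have "xv (Suc i) - xv i dvd xv (Suc i) ^ k - xv i ^ k" for k
    by (simp add: power_diff_sumr2)
  ultimately have "xv (Suc i) - xv i
      dvd swap_x i (Poly_Mapping.single m c) - Poly_Mapping.single m c"
    by (metis dvd_diff dvd_mult)
  moreover have "Poly_Mapping.update m c f = f + Poly_Mapping.single m c"
    using update.hyps
    by (intro poly_mapping_eqI)
      (auto simp: lookup_add lookup_single lookup_update when_def in_keys_iff)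
  then have "swap_x i (Poly_Mapping.update m c f) - Poly_Mapping.update m c f =
      (swap_x i f - f) + (swap_x i (Poly_Mapping.single m c) - Poly_Mapping.single m c)"
    by (simp add: swap_x_add)
  ultimately show ?case
    using update.IH by (metis dvd_add)
qed

lemma divided_difference_ex1: "\<exists>!g. g * (xv (Suc i) - xv i) = swap_x i f - f"
  using divided_difference_dvd[of i f] diff_x_nonzero[of i]
  by (auto simp: dvd_def mult.commute)

end

theory Submission
  imports Defs
begin

text \<open>
  The composition \<open>\<zeta> = (0,0,1)\<close> is a witness. Its minimal permutation is \<open>s\<^sub>2 s\<^sub>1\<close>, whose only reduced
  word is \<open>[2,1]\<close>, so \<open>K\<^sub>\<zeta> = T\<^sub>2 (T\<^sub>1 x\<^sub>1)\<close>. In the first step the summand \<open>- \<beta> x\<^sub>1\<close> cancels, and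
  \<open>T\<^sub>1 x\<^sub>1 = 1 + (\<alpha> + \<gamma>) x\<^sub>1 + \<gamma> x\<^sub>2 + (\<beta> + \<gamma>)(\<alpha> + \<gamma>) x\<^sub>1 x\<^sub>2\<close> has nonnegative coefficients. However, it is
  not homogeneous in the \<open>x\<^sub>i\<close>: its constant term \<open>1\<close> is killed by \<open>\<partial>\<^sub>2\<close>, so \<open>T\<^sub>2\<close> turns it into
  \<open>- \<beta>\<close>. The only other contribution to the part of \<open>T\<^sub>2 (T\<^sub>1 x\<^sub>1)\<close> free of all \<open>x\<^sub>i\<close> is \<open>\<partial>\<^sub>2 (\<gamma> x\<^sub>2) = \<gamma>\<close>,
  which does not compensate it. Hence this part is \<open>\<gamma> - \<beta>\<close>, and the monomial \<open>\<beta>\<close> has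
  coefficient \<open>-1\<close> in \<open>K\<^sub>\<zeta>\<close> (lemma \<open>K_poly_001\<close>).
\<close>

lemma swap_mon_add: "swap_mon i (m + k) = swap_mon i m + swap_mon i k"
  by (rule poly_mapping_eqI) (simp add: lookup_swap_mon lookup_add)

lemma poly_mapping_add_single_induct [case_names zero add]:
  fixes f :: "'a \<Rightarrow>\<^sub>0 'b::monoid_add"
  assumes "P 0" and step: "\<And>f m c. P f \<Longrightarrow> P (f + Poly_Mapping.single m c)"
  shows "P f"
proof (induction f rule: update_induct)
  case const
  show ?case using assms(1) .
next
  case (update f m c)
  have "Poly_Mapping.update m c f = f + Poly_Mapping.single m c"
    using update.hyps
    by (intro poly_mapping_eqI)
      (auto simp: lookup_add lookup_single lookup_update when_def in_keys_iff)
  then show ?case using step update.IH by simp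
qed

lemma swap_x_zero: "swap_x i 0 = 0"
  by (rule poly_mapping_eqI) (simp add: lookup_swap_x)

lemma swap_x_mult: "swap_x i (f * g) = swap_x i f * swap_x i g"
proof (induction f rule: poly_mapping_add_single_induct)
  case zero
  show ?case by (simp add: swap_x_zero)
next
  case (add f m c)
  have "swap_x i (Poly_Mapping.single m c * g) = swap_x i (Poly_Mapping.single m c) * swap_x i g"
    by (induction g rule: poly_mapping_add_single_induct)
      (simp_all add: swap_x_zero swap_x_add swap_x_single mult_single swap_mon_add distrib_left)
  with add show ?case
    by (simp add: swap_x_add distrib_right)
qed

lemma swap_x_Var: "swap_x i (Var v) = Var (transpose (X i) (X (Suc i)) v)"
proof -
  have "swap_mon i (Poly_Mapping.single v 1)
      = Poly_Mapping.single (transpose (X i) (X (Suc i)) v) 1"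
    by (rule poly_mapping_eqI)
      (auto simp: lookup_swap_mon lookup_single when_def transpose_def)
  then show ?thesis by (simp add: Var_def swap_x_single)
qed

lemma swap_x_one: "swap_x i 1 = 1"
proof -
  have "swap_mon i 0 = 0"
    by (rule poly_mapping_eqI) (simp add: lookup_swap_mon)
  then show ?thesis
    using swap_x_single[of i 0 1] by simp
qed

lemma divided_difference_eqI:
  assumes "g * (xv (Suc i) - xv i) = swap_x i f - f"
  shows "divided_difference i f = g"
  unfolding divided_difference_def
  using assms divided_difference_ex1 by (rule the1_equality[rotated])

text \<open>
  This isolates the part of a polynomial free of the \<open>x\<^sub>i\<close>: summands with a factor \<open>x\<^sub>i\<close> may be
  discarded without expanding them.
\<close>

lemma lookup_Var_mult_eq_0:
  assumes "Poly_Mapping.lookup m v = 0"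
  shows "Poly_Mapping.lookup (Var v * f) m = 0"
proof (rule ccontr)
  assume "Poly_Mapping.lookup (Var v * f) m \<noteq> 0"
  then have "m \<in> Poly_Mapping.keys (Var v * f)"
    by (simp add: in_keys_iff)
  then obtain a b where "a \<in> Poly_Mapping.keys (Var v)" "m = a + b"
    using keys_mult[of "Var v" f] by blast
  then have "m = Poly_Mapping.single v 1 + b"
    by (simp add: Var_def)
  with assms show False
    by (simp add: lookup_add)
qed

text \<open>
  A simple transposition raises a point by at most one, so the point \<open>1\<close> needs two letters to reach
  \<open>3\<close>, and these must be \<open>s\<^sub>1\<close>, acting first, and then \<open>s\<^sub>2\<close>.
\<close>

lemma word_perm_1_eq_3:
  assumes "set is \<subseteq> {1..<3}" and "length is \<le> 2" and "word_perm is 1 = 3"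
  shows "is = [2, 1]"
proof -
  consider "is = []" | i where "is = [i]" | i j where "is = [i, j]"
    using assms(2) by (cases "is"; cases "tl is"; cases "tl (tl is)") auto
  then show ?thesis
    using assms(1,3)
    by cases (auto simp: word_perm_def transpose_def split: if_splits)
qed

text \<open>
  Two words suffice to write the admissible permutations, so that \<open>perm_length\<close> is a genuine minimum
  for each of them. The longer one has length \<open>3\<close> but is beaten by \<open>[2, 1]\<close>.
\<close>

lemma permutes_1_eq_3_word:
  assumes v: "v permutes {1..3}" and v1: "v 1 = (3::nat)"
  shows "v = word_perm [2, 1] \<or> v = word_perm [1, 2, 1]"
proof -
  have set3: "{1..3::nat} = {1, 2, 3}" by auto
  have "v 2 \<in> {1, 2, 3}" "v 3 \<in> {1, 2, 3}"
    using permutes_in_image[OF v] unfolding set3 by auto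
  moreover have "v 2 \<noteq> v 1" "v 3 \<noteq> v 1" "v 3 \<noteq> v 2"
    using permutes_inj[OF v] by (auto simp: inj_eq)
  ultimately have cases: "v 2 = 1 \<and> v 3 = 2 \<or> v 2 = 2 \<and> v 3 = 1"
    using v1 by auto
  have out: "v x = x" if "x \<noteq> 1" "x \<noteq> 2" "x \<noteq> 3" for x
    using that permutes_not_in[OF v, of x] unfolding set3 by auto
  from cases show ?thesis
  proof (elim disjE conjE)
    assume "v 2 = 1" "v 3 = 2"
    then have "v = word_perm [2, 1]"
      using v1 out
      by (auto simp: fun_eq_iff word_perm_def transpose_def numeral_2_eq_2 numeral_3_eq_3)
    then show ?thesis ..
  next
    assume "v 2 = 2" "v 3 = 1"
    then have "v = word_perm [1, 2, 1]"
      using v1 out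
      by (auto simp: fun_eq_iff word_perm_def transpose_def numeral_2_eq_2 numeral_3_eq_3)
    then show ?thesis ..
  qed
qed

lemma part_001:
  "(\<forall>i\<in>{1..3}. part [0, 0, 1] (v i) = part (sorted_partition [0, 0, 1]) i) \<longleftrightarrow>
   part [0, 0, 1] (v 1) = 1 \<and> part [0, 0, 1] (v 2) = 0 \<and> part [0, 0, 1] (v 3) = 0"
proof -
  have "{1..3::nat} = {1, 2, 3}" by auto
  then show ?thesis by (simp add: part_def sorted_partition_def)
qed

lemma T_perm_min_perm_001:
  "T_perm 3 (min_perm [0, 0, 1]) f = T_op 2 (T_op 1 f)"
proof -
  define admissible where "admissible v \<longleftrightarrow> v permutes {1..3} \<and>
    (\<forall>i\<in>{1..3}. part [0, 0, 1] (v i) = part (sorted_partition [0, 0, 1]) i)" for v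
  define v where "v = min_perm [0, 0, 1]"
  have v_def': "v = arg_min (perm_length 3) admissible"
    by (simp add: v_def min_perm_def admissible_def[abs_def] numeral_3_eq_3)
  have "word_perm [2, 1] permutes {1..3}"
    by (simp add: word_perm_def permutes_compose permutes_swap_id)
  then have witness: "admissible (word_perm [2, 1])"
    unfolding admissible_def part_001 by (simp add: part_def word_perm_def transpose_def)
  have "perm_length 3 (word_perm [2, 1]) \<le> 2"
    unfolding perm_length_def by (rule Least_le) (rule exI[of _ "[2, 1]"], simp)
  then have short: "perm_length 3 v \<le> 2"
    using arg_min_nat_le[of admissible "word_perm [2, 1]" "perm_length 3"] witness v_def' by simp
  have "admissible v"
    unfolding v_def' using witness
    by (rule arg_min_natI[of admissible "word_perm [2, 1]" "perm_length 3"])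
  then have v: "v permutes {1..3}" and "part [0, 0, 1] (v 1) = 1"
    unfolding admissible_def part_001 by auto
  moreover have "v 1 = 1 \<or> v 1 = 2 \<or> v 1 = 3"
    using permutes_in_image[OF v, of 1] by auto
  ultimately have v1: "v 1 = 3"
    by (auto simp: part_def)
  have "\<exists>is. set is \<subseteq> {1..<3} \<and> word_perm is = v"
    using permutes_1_eq_3_word[OF v v1]
    by (elim disjE) (rule exI[of _ "[2, 1]"] exI[of _ "[1, 2, 1]"]; simp)+
  then have "\<exists>is. reduced_word 3 v is"
    unfolding reduced_word_def perm_length_def
    using LeastI_ex[of "\<lambda>l. \<exists>is. set is \<subseteq> {1..<3} \<and> word_perm is = v \<and> length is = l"] by auto
  then have "reduced_word 3 v (SOME is. reduced_word 3 v is)"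
    by (rule someI_ex)
  then have "(SOME is. reduced_word 3 v is) = [2, 1]"
    using word_perm_1_eq_3 short v1 by (auto simp: reduced_word_def)
  then show ?thesis
    unfolding T_perm_def v_def[symmetric] by simp
qed

lemma T_op_1_x1: "T_op 1 (xv 1) = 1 + (\<alpha> + \<gamma>) * xv 1 + \<gamma> * xv 2 + (\<beta> + \<gamma>) * (\<alpha> + \<gamma>) * xv 1 * xv 2"
proof -
  have "divided_difference 1 (xv 1) = 1"
    by (rule divided_difference_eqI) (simp add: swap_x_Var)
  then show ?thesis
    by (simp add: T_op_def numeral_2_eq_2 algebra_simps)
qed

lemma T_op_2_T_op_1_x1:
  "\<exists>p q r. T_op 2 (T_op 1 (xv 1)) = \<gamma> - \<beta> + xv 1 * p + xv 2 * q + xv 3 * r"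
proof -
  define f where "f = T_op 1 (xv 1)"
  define c where "c = (\<beta> + \<gamma>) * (\<alpha> + \<gamma>)"
  have "divided_difference 2 f = \<gamma> + c * xv 1"
    unfolding f_def T_op_1_x1 c_def
    by (rule divided_difference_eqI)
      (simp add: swap_x_add swap_x_mult swap_x_Var swap_x_one algebra_simps)
  then have "T_op 2 f = - \<beta> * f +
     ((\<alpha> + \<beta> + \<gamma>) * xv 2 + \<gamma> * xv 3 + 1 + c * xv 2 * xv 3) * (\<gamma> + c * xv 1)"
    by (simp add: T_op_def c_def numeral_3_eq_3 numeral_2_eq_2)
  also have "\<dots> = \<gamma> - \<beta> + xv 1 * (c - \<beta> * (\<alpha> + \<gamma>) - \<beta> * c * xv 2)
      + xv 2 * ((\<alpha> + \<beta> + \<gamma> + c * xv 3) * (\<gamma> + c * xv 1) - \<beta> * \<gamma>)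
      + xv 3 * (\<gamma> * (\<gamma> + c * xv 1))"
    unfolding f_def T_op_1_x1 c_def[symmetric] by (simp add: algebra_simps)
  finally show ?thesis unfolding f_def by blast
qed

lemma K_poly_001: "Poly_Mapping.lookup (K_poly [0, 0, 1]) (Poly_Mapping.single Beta 1) = -1"
proof -
  have "{1..3::nat} = {1, 2, 3}" by auto
  then have "(\<Prod>i\<in>{1..3}. xv i ^ part (sorted_partition [0, 0, 1]) i) = xv 1"
    by (simp add: part_def sorted_partition_def)
  then have "K_poly [0, 0, 1] = T_op 2 (T_op 1 (xv 1))"
    using T_perm_min_perm_001 by (simp add: K_poly_def numeral_3_eq_3)
  moreover obtain p q r
    where "T_op 2 (T_op 1 (xv 1)) = \<gamma> - \<beta> + xv 1 * p + xv 2 * q + xv 3 * r"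
    using T_op_2_T_op_1_x1 by blast
  moreover have "Poly_Mapping.lookup (xv i * s) (Poly_Mapping.single Beta 1) = 0" for i s
    by (rule lookup_Var_mult_eq_0) (simp add: lookup_single)
  moreover have "Poly_Mapping.single Gamma 1 \<noteq> Poly_Mapping.single Beta (1::nat)"
    by (metis indet.distinct(7) lookup_single_eq lookup_single_not_eq zero_neq_one)
  ultimately show ?thesis
    by (simp add: lookup_add lookup_minus) (simp add: Var_def lookup_single when_def)
qed

theorem proposition5p3:
  shows "\<exists>\<zeta> :: nat list. \<exists>m :: monomial. Poly_Mapping.lookup (K_poly \<zeta>) m < 0"
proof (intro exI)
  show "Poly_Mapping.lookup (K_poly [0, 0, 1]) (Poly_Mapping.single Beta 1) < 0"
    by (simp only: K_poly_001)
qed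

end
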